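(* Let $p$ be a prime and let $\Gamma=\Gamma(D_{2p^2})$ be the intersection graph of the dihedral group $D_{2p^2}$. Then $\operatorname{diam}(\Gamma)=3$. In particular, $\Gamma$ is connected.
   Context: For an integer $n\ge 3$, $D_{2n}=\langle r,s : r^n=s^2=1,\ srs=r^{-1}\rangle$ is the dihedral group of order $2n$. For a finite group $G$, the intersection graph $\Gamma(G)$ is the simple undirected graph whose vertex set is the set of all proper non-trivial subgroups of $G$, with two distinct vertices $H,K$ adjacent if and only if $H\cap K\neq\{e\}$. The distance $d(u,v)$ is the length of a shortest $u$–$v$ path, and $\operatorname{diam}(\Gamma)$ is the maximum distance between two vertices. *)

theory Defs
  imports
    "HOL-Algebra.Generated_Groups"
    "HOL-Computational_Algebra.Primes"
    "HOL-Library.Extended_Nat"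
    "Graph_Theory.Graph_Theory"
begin

section \<open>Dihedral groups\<close>

locale dihedral_relations = group G for G (structure) +
  fixes n :: nat and r s :: 'a
  assumes r_closed [simp]: "r \<in> carrier G"
    and s_closed [simp]: "s \<in> carrier G"
    and r_pow: "r [^] n = \<one>"
    and s_pow: "s [^] (2::nat) = \<one>"
    and s_r_s: "s \<otimes> r \<otimes> s = inv r"

text \<open>
  The group presented by \<open>\<langle>r, s : r^n = s^2 = 1, s r s = r^(-1)\<rangle>\<close> is, up to isomorphism, the
  group of order \<open>2n\<close> generated by two elements satisfying these relations. That such a group
  exists is lemma \<open>ex_dihedral_group\<close>; that every relation between \<open>r\<close> and \<open>s\<close> follows
  from the given ones, i.e. the universal property of the presentation, is lemma
  \<open>dihedral_universal\<close>.
\<close>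

locale dihedral_group = dihedral_relations +
  assumes n_ge_3: "3 \<le> n"
    and generated: "generate G {r, s} = carrier G"
    and order_eq: "order G = 2 * n"


section \<open>Distance and diameter\<close>

text \<open>
  The values are extended natural numbers: the distance between vertices not joined by a path,
  and hence the diameter of a disconnected graph, is \<open>\<infinity>\<close>.
\<close>

definition graph_dist :: "('a, 'b) pre_digraph \<Rightarrow> 'a \<Rightarrow> 'a \<Rightarrow> enat" where
  "graph_dist \<Gamma> u v = (INF p \<in> {p. pre_digraph.apath \<Gamma> u p v}. enat (length p))"

definition graph_diam :: "('a, 'b) pre_digraph \<Rightarrow> enat" where
  "graph_diam \<Gamma> = (SUP u \<in> verts \<Gamma>. SUP v \<in> verts \<Gamma>. graph_dist \<Gamma> u v)"


section \<open>Intersection graphs\<close>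

text \<open>
  Undirected graphs are represented in \<open>Graph_Theory\<close> by symmetric digraphs; see lemma
  \<open>pair_graph_intersection_graph\<close>.
\<close>

definition intersection_graph :: "('a, 'b) monoid_scheme \<Rightarrow> 'a set pair_pre_digraph" where
  "intersection_graph G =
    (let V = {H. subgroup H G \<and> H \<noteq> carrier G \<and> H \<noteq> {\<one>\<^bsub>G\<^esub>}}
     in \<lparr>pverts = V, parcs = {(H, K). H \<in> V \<and> K \<in> V \<and> H \<noteq> K \<and> H \<inter> K \<noteq> {\<one>\<^bsub>G\<^esub>}}\<rparr>)"

lemma pair_graph_intersection_graph:
  assumes "finite (carrier G)"
  shows "pair_graph (intersection_graph G)"
proof -
  let ?V = "pverts (intersection_graph G)"
  have "?V \<subseteq> Pow (carrier G)"
    by (auto simp: intersection_graph_def Let_def dest: subgroup.subset)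
  then have fin: "finite ?V"
    using assms finite_subset by blast
  have "parcs (intersection_graph G) \<subseteq> ?V \<times> ?V"
    by (auto simp: intersection_graph_def Let_def)
  then have fin_arcs: "finite (parcs (intersection_graph G))"
    using fin finite_subset by blast
  have arcs: "fst e \<in> ?V \<and> snd e \<in> ?V \<and> fst e \<noteq> snd e"
    if "e \<in> parcs (intersection_graph G)" for e
    using that by (cases e) (simp add: intersection_graph_def Let_def)
  have "symmetric (with_proj (intersection_graph G))"
    by (auto simp: intersection_graph_def Let_def symmetric_def sym_def)
  then show ?thesis
    using arcs fin fin_arcs by unfold_locales blast+
qed


section \<open>Existence and universal property of dihedral groups\<close>

context dihedral_relations begin

definition nf :: "int \<Rightarrow> bool \<Rightarrow> 'a" where
  "nf i b = r [^] i \<otimes> (if b then s else \<one>)"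

lemma nf_closed [simp]: "nf i b \<in> carrier G"
  by (simp add: nf_def)

lemma s_s [simp]: "s \<otimes> s = \<one>"
  using s_pow by (simp add: numeral_2_eq_2)

lemma s_r: "s \<otimes> r = inv r \<otimes> s"
proof -
  have "s \<otimes> r = s \<otimes> r \<otimes> (s \<otimes> s)" by simp
  also have "\<dots> = (s \<otimes> r \<otimes> s) \<otimes> s" by (simp add: m_assoc del: s_s)
  finally show ?thesis by (simp add: s_r_s)
qed

lemma s_inv_r: "s \<otimes> inv r = r \<otimes> s"
proof -
  have "s \<otimes> inv r = s \<otimes> (s \<otimes> r \<otimes> s)" by (simp add: s_r_s)
  also have "\<dots> = (s \<otimes> s) \<otimes> (r \<otimes> s)" by (simp add: m_assoc del: s_s)
  finally show ?thesis by simp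
qed

lemma s_pow_nat: 
  assumes "x \<in> carrier G" "y \<in> carrier G" "s \<otimes> x = y \<otimes> s"
  shows "s \<otimes> x [^] (k::nat) = y [^] k \<otimes> s"
proof (induction k)
  case (Suc k)
  have "s \<otimes> x [^] Suc k = (s \<otimes> x [^] k) \<otimes> x" using assms by (simp add: m_assoc)
  also have "\<dots> = y [^] k \<otimes> (s \<otimes> x)" using assms Suc by (simp add: m_assoc)
  also have "\<dots> = y [^] Suc k \<otimes> s" using assms by (simp add: m_assoc)
  finally show ?case .
qed simp

lemma s_pow_int: "s \<otimes> r [^] (k::int) = r [^] (- k) \<otimes> s"
proof (cases k rule: int_cases2)
  case (nonneg m)
  have "s \<otimes> r [^] m = inv r [^] m \<otimes> s" by (rule s_pow_nat) (simp_all add: s_r)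
  then show ?thesis using nonneg by (simp add: int_pow_neg int_pow_int nat_pow_inv)
next
  case (nonpos m)
  have "s \<otimes> inv r [^] m = r [^] m \<otimes> s" by (rule s_pow_nat) (simp_all add: s_inv_r)
  then show ?thesis using nonpos by (simp add: int_pow_neg int_pow_int nat_pow_inv)
qed

lemma nf_mult: "nf i a \<otimes> nf j b = nf (i + (if a then - j else j)) (a \<noteq> b)"
proof (cases a)
  case True
  have "nf i a \<otimes> nf j b = r [^] i \<otimes> (s \<otimes> r [^] j) \<otimes> (if b then s else \<one>)"
    using True by (simp add: nf_def m_assoc)
  also have "\<dots> = (r [^] i \<otimes> r [^] (- j)) \<otimes> (s \<otimes> (if b then s else \<one>))"
    unfolding s_pow_int by (simp add: m_assoc del: s_s)
  also have "r [^] i \<otimes> r [^] (- j) = r [^] (i + - j)"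
    by (simp only: int_pow_mult r_closed)
  finally show ?thesis using True by (simp add: nf_def)
next
  case False
  then show ?thesis by (simp add: nf_def int_pow_mult m_assoc)
qed

lemma nf_one: "nf 0 False = \<one>" and nf_r: "nf 1 False = r" and nf_s: "nf 0 True = s"
  by (simp_all add: nf_def int_pow_1)

lemma nf_mod: "nf (i mod int n) b = nf i b"
proof -
  have "r [^] i = r [^] (int n * (i div int n) + i mod int n)" by simp
  also have "\<dots> = (r [^] int n) [^] (i div int n) \<otimes> r [^] (i mod int n)"
    by (simp only: int_pow_mult int_pow_pow r_closed)
  also have "\<dots> = r [^] (i mod int n)" by (simp add: int_pow_int r_pow)
  finally show ?thesis by (simp add: nf_def)
qed

lemma generate_nf: "generate G {r, s} = range (case_prod nf)"
proof
  show "generate G {r, s} \<subseteq> range (case_prod nf)"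
  proof
    fix x assume "x \<in> generate G {r, s}"
    then have "\<exists>i b. x = nf i b"
    proof induction
      case one then show ?case by (metis nf_one)
    next
      case (incl h) then show ?case by (metis nf_r nf_s insertE singletonD)
    next
      case (inv h)
      have "inv r = nf (- 1) False" by (simp add: nf_def int_pow_neg int_pow_1)
      moreover have "inv s = s" by (simp add: inv_equality)
      ultimately show ?case using inv by (metis nf_s insertE singletonD)
    next
      case (eng g h) then show ?case by (metis nf_mult)
    qed
    then show "x \<in> range (case_prod nf)" by force
  qed
next
  have rs: "{r, s} \<subseteq> carrier G" by simp
  interpret gen: subgroup "generate G {r, s}" G
    by (rule generate_is_subgroup[OF rs])
  have "r \<in> generate G {r, s}" "s \<in> generate G {r, s}"
    by (auto intro: generate.incl)
  then have "nf i b \<in> generate G {r, s}" for i b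
    using subgroup_int_pow_closed[OF gen.subgroup_axioms] by (simp add: nf_def)
  then show "range (case_prod nf) \<subseteq> generate G {r, s}" by auto
qed

end

context dihedral_group begin

lemma nf_bij: "bij_betw (case_prod nf) ({0..<int n} \<times> UNIV) (carrier G)"
proof -
  have "case_prod nf ` ({0..<int n} \<times> UNIV) = range (case_prod nf)"
  proof (intro equalityI subsetI)
    fix x assume "x \<in> range (case_prod nf)"
    then obtain i b where "x = nf i b" by auto
    then have "x = case_prod nf (i mod int n, b)" by (simp add: nf_mod)
    moreover have "(i mod int n, b) \<in> {0..<int n} \<times> UNIV" using n_ge_3 by simp
    ultimately show "x \<in> case_prod nf ` ({0..<int n} \<times> UNIV)" by blast
  qed auto
  then have im: "case_prod nf ` ({0..<int n} \<times> UNIV) = carrier G"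
    using generated generate_nf by simp
  have "card ({0..<int n} \<times> (UNIV::bool set)) = card (carrier G)"
    using order_eq by (simp add: card_cartesian_product order_def)
  then have "inj_on (case_prod nf) ({0..<int n} \<times> UNIV)"
    by (intro eq_card_imp_inj_on) (simp_all add: im)
  then show ?thesis
    using im by (rule bij_betw_imageI)
qed

lemma nf_eqD:
  assumes "nf i a = nf j b"
  shows "i mod int n = j mod int n" "a = b"
proof -
  have "case_prod nf (i mod int n, a) = case_prod nf (j mod int n, b)"
    using assms by (simp add: nf_mod)
  then have "(i mod int n, a) = (j mod int n, b)"
    by (rule inj_onD [OF bij_betw_imp_inj_on [OF nf_bij]]) (use n_ge_3 in simp_all)
  then show "i mod int n = j mod int n" "a = b" by simp_all
qed

lemma ex_nf: "x \<in> carrier G \<Longrightarrow> \<exists>i b. x = nf i b"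
  unfolding generated [symmetric] generate_nf by auto

lemma dihedral_universal:
  assumes "dihedral_relations H n r' s'"
  shows "\<exists>h \<in> hom G H. h r = r' \<and> h s = s'"
proof -
  interpret H: dihedral_relations H n r' s' by fact
  define h where "h x = (THE y. \<exists>i b. x = nf i b \<and> y = H.nf i b)" for x
  have h: "h (nf i b) = H.nf i b" for i b
    unfolding h_def
  proof (rule the_equality)
    show "\<exists>j c. nf i b = nf j c \<and> H.nf i b = H.nf j c" by blast
    fix y assume "\<exists>j c. nf i b = nf j c \<and> y = H.nf j c"
    then obtain j c where "nf i b = nf j c" and y: "y = H.nf j c" by blast
    then have "i mod int n = j mod int n" "b = c" using nf_eqD by blast+
    then have "H.nf (j mod int n) c = H.nf (i mod int n) b" by simp
    then show "y = H.nf i b" unfolding y H.nf_mod .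
  qed
  have "h \<in> hom G H"
  proof (rule homI)
    fix x y assume "x \<in> carrier G" "y \<in> carrier G"
    then obtain i a j b where xy: "x = nf i a" "y = nf j b" using ex_nf by metis
    show "h x \<in> carrier H" by (simp add: xy h)
    show "h (x \<otimes> y) = h x \<otimes>\<^bsub>H\<^esub> h y" by (simp add: xy h nf_mult H.nf_mult)
  qed
  moreover have "h r = r'" "h s = s'"
    using h[of 1 False] h[of 0 True] by (simp_all add: nf_r nf_s H.nf_r H.nf_s)
  ultimately show ?thesis by blast
qed

end

lemma ex_dihedral_group:
  assumes n: "3 \<le> n"
  shows "\<exists>(G :: (int \<times> bool) monoid) r s. dihedral_group G n r s"
proof -
  define G :: "(int \<times> bool) monoid" where
    "G = \<lparr>carrier = {0..<int n} \<times> UNIV,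
          monoid.mult = (\<lambda>(i, a) (j, b). ((i + (if a then - j else j)) mod int n, a \<noteq> b)),
          monoid.one = (0, False)\<rparr>"
  have [simp]: "carrier G = {0..<int n} \<times> UNIV" "\<one>\<^bsub>G\<^esub> = (0, False)"
    by (simp_all add: G_def)
  have mult_eq [simp]:
    "(i, a) \<otimes>\<^bsub>G\<^esub> (j, b) = ((i + (if a then - j else j)) mod int n, a \<noteq> b)" for i a j b
    by (simp add: G_def)
  interpret group G
  proof (rule groupI)
    fix x y z :: "int \<times> bool"
    obtain i a j b k c where xyz: "x = (i, a)" "y = (j, b)" "z = (k, c)"
      by (metis surj_pair)
    let ?f = "\<lambda>a j. if a then - j else j :: int"
    have "((i + ?f a j) mod int n + ?f (a \<noteq> b) k) mod int n = (i + ?f a j + ?f (a \<noteq> b) k) mod int n"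
      by (rule mod_add_left_eq)
    also have "\<dots> = (i + ?f a (j + ?f b k)) mod int n"
      by (rule arg_cong [where f = "\<lambda>m. m mod int n"]) simp
    also have "\<dots> = (i + ?f a ((j + ?f b k) mod int n)) mod int n"
      by (cases a) (simp_all only: if_True if_False mod_add_right_eq
        diff_conv_add_uminus [symmetric] mod_diff_right_eq)
    finally show "x \<otimes>\<^bsub>G\<^esub> y \<otimes>\<^bsub>G\<^esub> z = x \<otimes>\<^bsub>G\<^esub> (y \<otimes>\<^bsub>G\<^esub> z)"
      by (auto simp only: xyz mult_eq)
  next
    fix x assume x: "x \<in> carrier G"
    obtain i a where xi: "x = (i, a)" by (cases x)
    show "\<exists>y \<in> carrier G. y \<otimes>\<^bsub>G\<^esub> x = \<one>\<^bsub>G\<^esub>"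
    proof (rule bexI)
      show "(if a then i else (- i) mod int n, a) \<otimes>\<^bsub>G\<^esub> x = \<one>\<^bsub>G\<^esub>"
        by (simp add: xi mod_simps)
    qed (use x xi n in auto)
  qed (use n in \<open>auto split: prod.splits\<close>)
  have pow: "(1, False) [^]\<^bsub>G\<^esub> k = (int k mod int n, False)" for k :: nat
    by (induction k) (use n in \<open>auto simp: mod_simps algebra_simps\<close>)
  interpret dihedral_relations G n "(1, False)" "(0, True)"
  proof
    have "inv\<^bsub>G\<^esub> (1, False) = (- 1 mod int n, False)"
      by (rule inv_equality) (use n in \<open>auto simp: mod_simps\<close>)
    then show "(0, True) \<otimes>\<^bsub>G\<^esub> (1, False) \<otimes>\<^bsub>G\<^esub> (0, True) = inv\<^bsub>G\<^esub> (1, False)"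
      by simp
  qed (use n in \<open>auto simp: pow numeral_2_eq_2\<close>)
  have "dihedral_group G n (1, False) (0, True)"
  proof
    show "generate G {(1, False), (0, True)} = carrier G"
    proof
      show "generate G {(1, False), (0, True)} \<subseteq> carrier G"
        by (rule generate_incl) (use n in auto)
      show "carrier G \<subseteq> generate G {(1, False), (0, True)}"
      proof
        fix x assume "x \<in> carrier G"
        then obtain i b where x: "x = (i, b)" "0 \<le> i" "i < int n" by (cases x) auto
        have "(1, False) [^]\<^bsub>G\<^esub> int (nat i) = (i, False)"
          using x by (simp only: int_pow_int pow) simp
        then have "nf i b = x"
          using x by (simp add: nf_def)
        then show "x \<in> generate G {(1, False), (0, True)}"
          unfolding generate_nf by force
      qed
    qed
    show "order G = 2 * n" by (simp add: order_def card_cartesian_product)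
  qed (rule n)
  then show ?thesis by blast
qed

end

theory Submission
  imports Defs
begin

text \<open>
  Two subgroups generated by reflections are at distance at least 3 whenever the two reflections
  generate the group, because a common neighbour would contain both. Conversely, for a proper
  divisor \<open>d > 1\<close> of \<open>n\<close>, every proper non-trivial subgroup meets non-trivially some proper
  subgroup containing the rotation \<open>r^d\<close>: either \<open>\<langle>r\<rangle>\<close> or \<open>\<langle>r^d, r^i s\<rangle>\<close>. Any two of the latter
  meet in \<open>r^d\<close>, so any two vertices are joined by a walk of length at most 3.
\<close>

section \<open>Distances in graphs\<close>

text \<open>Cutting a closed subwalk out of a walk keeps its ends and does not lengthen it;
  repeating this ends at a path.\<close>

lemma (in wf_digraph) apath_le_awalk:
  assumes "awalk u p v"
  shows "\<exists>q. apath u q v \<and> length q \<le> length p"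
  using assms
proof (induction rule: awalk_to_apath_induct)
  case (path p)
  then show ?case by (auto simp: apath_def)
next
  case (decomp p q r s)
  then have "p = q @ r @ s" by (blast elim: awalk_cyc_decompE)
  moreover obtain q' where "apath u q' v" "length q' \<le> length (q @ s)" using decomp by blast
  ultimately show ?case by (intro exI [of _ q']) simp
qed

text \<open>\<open>graph_dist\<close> ranges over paths, but walks are what can be concatenated
  freely.\<close>

lemma (in wf_digraph) graph_dist_le_awalk:
  assumes "awalk u p v"
  shows "graph_dist G u v \<le> enat (length p)"
proof -
  obtain q where "apath u q v" "length q \<le> length p"
    using apath_le_awalk [OF assms] by blast
  then show ?thesis unfolding graph_dist_def
    by (intro INF_lower2 [of q]) auto
qed

text \<open>Every path is a walk. If there is none, the infimum is \<infinity> and the bound still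
  holds.\<close>

lemma le_graph_dist:
  assumes "\<And>p. pre_digraph.awalk \<Gamma> u p v \<Longrightarrow> k \<le> length p"
  shows "enat k \<le> graph_dist \<Gamma> u v"
  unfolding graph_dist_def
  by (rule INF_greatest) (auto intro: assms pre_digraph.awalkI_apath)

section \<open>Intersection graphs\<close>

lemma mem_pverts_intersection_graph:
  "H \<in> pverts (intersection_graph G) \<longleftrightarrow>
    subgroup H G \<and> H \<noteq> carrier G \<and> H \<noteq> {\<one>\<^bsub>G\<^esub>}"
  by (simp add: intersection_graph_def Let_def)

lemma mem_parcs_intersection_graph:
  "(H, K) \<in> parcs (intersection_graph G) \<longleftrightarrow>
    H \<in> pverts (intersection_graph G) \<and> K \<in> pverts (intersection_graph G) \<and>
    H \<noteq> K \<and> H \<inter> K \<noteq> {\<one>\<^bsub>G\<^esub>}"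
  by (simp add: intersection_graph_def Let_def)

text \<open>Allowing the empty walk covers \<open>H = K\<close>, so later concatenations need no
  distinctness of vertices.\<close>

lemma awalk_intersection_graph_le_1:
  assumes "H \<in> pverts (intersection_graph G)" "K \<in> pverts (intersection_graph G)"
    and "x \<in> H" "x \<in> K" "x \<noteq> \<one>\<^bsub>G\<^esub>"
  shows "\<exists>p. pre_digraph.awalk (with_proj (intersection_graph G)) H p K \<and> length p \<le> 1"
proof (cases "H = K")
  case True
  then show ?thesis
    using assms by (intro exI [of _ "[]"]) (simp add: pre_digraph.awalk_def pre_digraph.cas.simps)
next
  case False
  have "H \<inter> K \<noteq> {\<one>\<^bsub>G\<^esub>}" using assms by blast
  then show ?thesis
    using assms False
    by (intro exI [of _ "[(H, K)]"])
      (simp add: pre_digraph.awalk_def pre_digraph.cas.simps mem_parcs_intersection_graph)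
qed

section \<open>Subgroups of dihedral groups\<close>

context dihedral_relations begin

text \<open>Every reflection is an involution, so only rotations change their exponent.\<close>

lemma inv_nf: "inv (nf i b) = nf (if b then i else - i) b"
  by (rule inv_equality) (simp_all add: nf_mult nf_one)

text \<open>The sets below are \<open>\<langle>r\<rangle>\<close> and, for \<open>d\<close> dividing \<open>n\<close>, \<open>\<langle>r^d, r^i s\<rangle>\<close>.\<close>

definition rotations :: "'a set" where
  "rotations = range (\<lambda>j. nf j False)"

definition subdihedral :: "nat \<Rightarrow> int \<Rightarrow> 'a set" where
  "subdihedral d i = {nf j b | j b. int d dvd j - (if b then i else 0)}"

lemma nf_in_rotations: "nf j False \<in> rotations"
  by (simp add: rotations_def)

lemma nf_in_subdihedral: "int d dvd j - (if b then i else 0) \<Longrightarrow> nf j b \<in> subdihedral d i"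
  unfolding subdihedral_def by blast

lemma subgroup_rotations: "subgroup rotations G"
  by unfold_locales (auto simp: rotations_def nf_mult inv_nf simp flip: nf_one)

lemma subgroup_subdihedral: "subgroup (subdihedral d i) G"
proof
  show "subdihedral d i \<subseteq> carrier G" by (auto simp: subdihedral_def)
  show "\<one> \<in> subdihedral d i" using nf_in_subdihedral [of d 0 False i] by (simp add: nf_one)
next
  fix x y assume "x \<in> subdihedral d i" "y \<in> subdihedral d i"
  then obtain j a k b where x: "x = nf j a" "int d dvd j - (if a then i else 0)"
    and y: "y = nf k b" "int d dvd k - (if b then i else 0)"
    by (auto simp: subdihedral_def)
  \<comment> \<open>The deviations of the two exponents from their prescribed residues modulo
    \<open>d\<close> combine with the sign of \<open>nf_mult\<close>; for two reflections the copies
    of \<open>i\<close> cancel.\<close>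
  have "int d dvd (j - (if a then i else 0)) +
      (if a then - (k - (if b then i else 0)) else k - (if b then i else 0))"
    using x y by (intro dvd_add) (auto simp: dvd_diff_commute)
  also have "\<dots> = j + (if a then - k else k) - (if a \<noteq> b then i else 0)"
    by auto
  finally show "x \<otimes> y \<in> subdihedral d i"
    unfolding x y nf_mult by (rule nf_in_subdihedral)
next
  fix x assume "x \<in> subdihedral d i"
  then obtain j b where x: "x = nf j b" "int d dvd j - (if b then i else 0)"
    by (auto simp: subdihedral_def)
  show "inv x \<in> subdihedral d i"
    unfolding x(1) inv_nf by (rule nf_in_subdihedral) (use x(2) in \<open>cases b; simp\<close>)
qed

end

context dihedral_group begin

lemma nf_eq_one_iff: "nf i b = \<one> \<longleftrightarrow> int n dvd i \<and> \<not> b"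
proof
  assume "nf i b = \<one>"
  then have "nf i b = nf 0 False" by (simp add: nf_one)
  from nf_eqD [OF this] show "int n dvd i \<and> \<not> b" by (simp add: dvd_eq_mod_eq_0)
next
  assume "int n dvd i \<and> \<not> b"
  then show "nf i b = \<one>" using nf_mod [of i False] by (simp add: nf_one)
qed

lemma rotations_ne_carrier: "rotations \<noteq> carrier G"
proof
  assume "rotations = carrier G"
  then have "nf 0 True \<in> rotations" by simp
  then obtain j where "nf 0 True = nf j False" by (auto simp: rotations_def)
  then show False using nf_eqD by blast
qed

text \<open>The element \<open>r\<close> is missing: its exponent is determined only modulo
  \<open>n\<close>, but as \<open>d\<close> divides \<open>n\<close>, divisibility by
  \<open>d\<close> does not depend on the representative, and \<open>d\<close> does not divide
  1.\<close>

lemma subdihedral_ne_carrier: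
  assumes "d dvd n" "1 < d"
  shows "subdihedral d i \<noteq> carrier G"
proof
  assume "subdihedral d i = carrier G"
  then have "nf 1 False \<in> subdihedral d i" by simp
  then obtain j b where "nf 1 False = nf j b" and dvd: "int d dvd j - (if b then i else 0)"
    by (auto simp: subdihedral_def)
  from nf_eqD [OF this(1)] have "1 mod int n = j mod int n" and "\<not> b" by simp_all
  then have "int n dvd 1 - j" by (simp add: mod_eq_dvd_iff)
  then have "int d dvd (1 - j) + j"
    using assms dvd \<open>\<not> b\<close> by (intro dvd_add) (auto intro: dvd_trans [of "int d" "int n"])
  then show False using \<open>1 < d\<close> by simp
qed

section \<open>Upper bound: walks of length at most 3\<close>

lemma ex_subgroup_with_rotation:
  assumes d: "d dvd n" "1 < d" "d < n"
    and H: "H \<in> pverts (intersection_graph G)"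
  shows "\<exists>K \<in> pverts (intersection_graph G). nf (int d) False \<in> K \<and> (\<exists>x \<in> H \<inter> K. x \<noteq> \<one>)"
proof -
  have nontriv: "nf (int d) False \<noteq> \<one>"
    using d by (auto simp: nf_eq_one_iff dest: dvd_imp_le)
  interpret H: subgroup H G
    using H by (simp add: mem_pverts_intersection_graph)
  obtain x where x: "x \<in> H" "x \<noteq> \<one>"
    using H H.one_closed by (auto simp: mem_pverts_intersection_graph)
  obtain i b where xi: "x = nf i b" using ex_nf H.subset x by blast
  \<comment> \<open>A single non-identity element \<open>x\<close> of \<open>H\<close> determines
    \<open>K\<close>, according to whether \<open>x\<close> is a reflection or a rotation.\<close>
  define K where "K = (if b then subdihedral d i else rotations)"
  have "nf (int d) False \<in> K" "x \<in> K"
    by (auto simp: K_def xi intro: nf_in_rotations nf_in_subdihedral)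
  moreover have "subgroup K G" "K \<noteq> carrier G"
    using d by (auto simp: K_def subgroup_rotations subgroup_subdihedral
        rotations_ne_carrier subdihedral_ne_carrier)
  ultimately show ?thesis
    using nontriv x by (auto simp: mem_pverts_intersection_graph)
qed

lemma awalk_le_3:
  assumes d: "d dvd n" "1 < d" "d < n"
    and H: "H \<in> pverts (intersection_graph G)" "H' \<in> pverts (intersection_graph G)"
  shows "\<exists>p. pre_digraph.awalk (with_proj (intersection_graph G)) H p H' \<and> length p \<le> 3"
proof -
  interpret \<Gamma>: wf_digraph "with_proj (intersection_graph G)"
    by unfold_locales (auto simp: mem_parcs_intersection_graph)
  obtain K x where K: "K \<in> pverts (intersection_graph G)" "nf (int d) False \<in> K"
    "x \<in> H" "x \<in> K" "x \<noteq> \<one>"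
    using ex_subgroup_with_rotation [OF d H(1)] by blast
  obtain K' y where K': "K' \<in> pverts (intersection_graph G)" "nf (int d) False \<in> K'"
    "y \<in> H'" "y \<in> K'" "y \<noteq> \<one>"
    using ex_subgroup_with_rotation [OF d H(2)] by blast
  have nontriv: "nf (int d) False \<noteq> \<one>"
    using d by (auto simp: nf_eq_one_iff dest: dvd_imp_le)
  \<comment> \<open>The three pieces are witnessed by the common elements \<open>x\<close>,
    \<open>r^d\<close> and \<open>y\<close>; \<open>0 < d < n\<close> ensures that
    \<open>r^d\<close> is not the identity.\<close>
  obtain p1 p2 p3 where "\<Gamma>.awalk H p1 K" "\<Gamma>.awalk K p2 K'" "\<Gamma>.awalk K' p3 H'"
    and "length p1 \<le> 1" "length p2 \<le> 1" "length p3 \<le> 1"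
    using awalk_intersection_graph_le_1 [OF H(1) K(1,3,4,5)]
      awalk_intersection_graph_le_1 [OF K(1) K'(1) K(2) K'(2) nontriv]
      awalk_intersection_graph_le_1 [OF K'(1) H(2) K'(4,3,5)]
    by blast
  then show ?thesis
    by (intro exI [of _ "p1 @ p2 @ p3"]) (auto intro: \<Gamma>.awalk_appendI simp del: \<Gamma>.awalk_append_iff)
qed

section \<open>Lower bound: two reflection subgroups at distance at least 3\<close>

lemma reflection_subgroup: "{\<one>, nf i True} \<in> pverts (intersection_graph G)"
proof -
  have "subgroup {\<one>, nf i True} G"
    by unfold_locales (auto simp: nf_mult inv_nf nf_one)
  \<comment> \<open>The rotation \<open>r\<close> shows properness: it is no reflection, and it is
    not the identity since \<open>n\<close> is at least 3.\<close>
  moreover have "nf 1 False \<notin> {\<one>, nf i True}"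
    using n_ge_3 nf_eqD(2) by (auto simp: nf_eq_one_iff)
  then have "{\<one>, nf i True} \<noteq> carrier G" by (metis nf_closed)
  moreover have "nf i True \<noteq> \<one>" by (simp add: nf_eq_one_iff)
  ultimately show ?thesis by (auto simp: mem_pverts_intersection_graph)
qed

text \<open>The product of \<open>r s\<close> and \<open>s\<close> is \<open>r\<close>, so
  \<open>H\<close> contains both generators.\<close>

lemma subgroup_with_two_reflections:
  assumes "subgroup H G" "nf 0 True \<in> H" "nf 1 True \<in> H"
  shows "H = carrier G"
proof -
  interpret H: subgroup H G by fact
  have "nf 1 True \<otimes> nf 0 True \<in> H" using assms by blast
  then have "r \<in> H" by (simp add: nf_mult nf_r)
  then have "{r, s} \<subseteq> H" using assms by (simp add: nf_s)
  then have "carrier G \<subseteq> H"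
    unfolding generated [symmetric] using generate_subgroup_incl assms(1) by blast
  then show ?thesis using H.subset by blast
qed

lemma reflections_far_apart:
  assumes "pre_digraph.awalk (with_proj (intersection_graph G)) {\<one>, nf 0 True} p {\<one>, nf 1 True}"
  shows "3 \<le> length p"
proof (rule ccontr)
  interpret \<Gamma>: wf_digraph "with_proj (intersection_graph G)"
    by unfold_locales (auto simp: mem_parcs_intersection_graph)
  assume "\<not> 3 \<le> length p"
  then have "length p = 0 \<or> length p = Suc 0 \<or> length p = Suc (Suc 0)" by linarith
  then consider "p = []" | e where "p = [e]" | e f where "p = [e, f]"
    unfolding length_Suc_conv length_0_conv by blast
  moreover have ne: "nf 0 True \<noteq> nf 1 True"
    using nf_eqD(1) [of 0 True 1 True] n_ge_3 by auto
  moreover have nt: "nf i True \<noteq> \<one>" for i by (simp add: nf_eq_one_iff)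
  ultimately show False
  proof cases
    case 1
    then show False using assms ne nt
      by (auto simp: \<Gamma>.awalk_Nil_iff doubleton_eq_iff)
  next
    case 2
    then have "{\<one>, nf 0 True} \<inter> {\<one>, nf 1 True} \<noteq> {\<one>}"
      using assms by (cases e) (simp add: \<Gamma>.awalk_simps mem_parcs_intersection_graph)
    then show False using ne by auto
  next
    case 3
    then obtain K where
      "({\<one>, nf 0 True}, K) \<in> parcs (intersection_graph G)"
      "(K, {\<one>, nf 1 True}) \<in> parcs (intersection_graph G)"
      using assms by (cases e; cases f) (auto simp: \<Gamma>.awalk_simps)
    then have K: "subgroup K G" "K \<noteq> carrier G"
      and "{\<one>, nf 0 True} \<inter> K \<noteq> {\<one>}" "K \<inter> {\<one>, nf 1 True} \<noteq> {\<one>}"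
      by (simp_all add: mem_parcs_intersection_graph mem_pverts_intersection_graph)
    moreover have "\<one> \<in> K" using K(1) by (rule subgroup.one_closed)
    \<comment> \<open>Each end vertex has only one non-identity element, so meeting \<open>K\<close>
      non-trivially forces that reflection into \<open>K\<close>.\<close>
    ultimately have "nf 0 True \<in> K" "nf 1 True \<in> K" by auto
    then show False using subgroup_with_two_reflections K by blast
  qed
qed

section \<open>Diameter and connectedness\<close>

text \<open>The argument uses only a proper divisor of \<open>n\<close>, so it covers every
  composite \<open>n\<close>.\<close>

theorem diam_and_connected_intersection_graph:
  assumes d: "d dvd n" "1 < d" "d < n"
  shows "graph_diam (with_proj (intersection_graph G)) = 3"
    and "connected (with_proj (intersection_graph G))"
proof -
  let ?\<Gamma> = "with_proj (intersection_graph G)"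
  interpret \<Gamma>: wf_digraph ?\<Gamma>
    by unfold_locales (auto simp: mem_parcs_intersection_graph)
  have "graph_dist ?\<Gamma> H K \<le> 3"
    if HK: "H \<in> verts ?\<Gamma>" "K \<in> verts ?\<Gamma>" for H K
  proof -
    obtain p where "\<Gamma>.awalk H p K" "length p \<le> 3"
      using awalk_le_3 [OF d] HK unfolding with_proj_simps by blast
    then have "graph_dist ?\<Gamma> H K \<le> enat (length p)" by (simp add: \<Gamma>.graph_dist_le_awalk)
    also have "\<dots> \<le> enat 3" using \<open>length p \<le> 3\<close> by simp
    finally show ?thesis by (simp add: numeral_eq_enat)
  qed
  then have "graph_diam ?\<Gamma> \<le> 3"
    unfolding graph_diam_def by (intro SUP_least)
  moreover have "3 \<le> graph_dist ?\<Gamma> {\<one>, nf 0 True} {\<one>, nf 1 True}"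
    using le_graph_dist [OF reflections_far_apart] by (simp add: numeral_eq_enat)
  then have "3 \<le> graph_diam ?\<Gamma>"
    unfolding graph_diam_def
    by (intro SUP_upper2 [of "{\<one>, nf 0 True}"] SUP_upper2 [of "{\<one>, nf 1 True}"])
      (simp_all add: reflection_subgroup)
  ultimately show "graph_diam ?\<Gamma> = 3" by (rule antisym)
  show "connected ?\<Gamma>"
    \<comment> \<open>\<open>connected\<close> means strong connectedness of the symmetric closure,
      to which the walks found in the graph itself carry over.\<close>
    unfolding connected_def
  proof (rule strongly_connectedI)
    show "verts (with_proj (mk_symmetric ?\<Gamma>)) \<noteq> {}"
      using reflection_subgroup by auto
    fix H K assume "H \<in> verts (with_proj (mk_symmetric ?\<Gamma>))" "K \<in> verts (with_proj (mk_symmetric ?\<Gamma>))"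
    then obtain p where "\<Gamma>.awalk H p K"
      using awalk_le_3 [OF d] unfolding with_proj_simps pverts_mk_symmetric by blast
    then have "H \<rightarrow>\<^sup>*\<^bsub>?\<Gamma>\<^esub> K" by (rule \<Gamma>.reachable_awalkI)
    then show "H \<rightarrow>\<^sup>*\<^bsub>with_proj (mk_symmetric ?\<Gamma>)\<^esub> K"
      by (rule \<Gamma>.reachable_mk_symmetricI)
  qed
qed

end

theorem theorem2p4:
  fixes G :: "('a, 'b) monoid_scheme" and r s :: 'a and p :: nat
  assumes "prime p"
    and "dihedral_group G (p ^ 2) r s"
  shows "graph_diam (with_proj (intersection_graph G)) = 3
    \<and> connected (with_proj (intersection_graph G))"
proof -
  have "1 < p" using assms(1) by (rule prime_gt_1_nat)
  \<comment> \<open>The proper divisor \<open>d\<close> of \<open>n = p ^ 2\<close> is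
    \<open>p\<close> itself.\<close>
  then have "p dvd p ^ 2" "p < p ^ 2" by (simp_all add: power2_eq_square)
  then show ?thesis
    using dihedral_group.diam_and_connected_intersection_graph [OF assms(2)] \<open>1 < p\<close> by blast
qed

end
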